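(* There is an absolute constant $C>0$ such that for every $n\ge1$, every function $g:\{0,1\}^n\to\{0,1\}$ and every bit-wise product distribution $\mu$ on $\{0,1\}^n$, $$\mathsf{QC}^\mu_{0.49}(g)\le C\left(\log \mathsf{qprt}_{1/8}(g)\cdot\log\log \mathsf{qprt}_{1/8}(g)\right)^2 + C.$$
   Context: A distribution $\mu$ on $\{0,1\}^n$ is bit-wise product if there are $p_i(0),p_i(1)\in[0,1]$ with $p_i(0)+p_i(1)=1$ such that $\mu(x)=\prod_{i=1}^n p_i(x_i)$. $\mathsf{QC}^\mu_\epsilon(g)$ is the minimum depth of a deterministic decision tree $T$ with $\Pr_{x\sim\mu}[T(x)\ne g(x)]\le\epsilon$. For $s\in\{0,1,\star\}^n$, the subcube with support $s$ is $\{x: s_i\neq\star\Rightarrow x_i=s_i\}$; for a subcube $A$ with support $s$, $|A|$ denotes the number of $i$ with $s_i\in\{0,1\}$. The $\epsilon$-query partition bound $\mathsf{qprt}_\epsilon(g)$ is the optimal value of the LP: minimize $\sum_{z\in\{0,1\}}\sum_A w_{z,A}2^{|A|}$ over subcubes $A$, subject to $\sum_{A\ni x} w_{g(x),A}\ge 1-\epsilon$ for all $x$; $\sum_{A\ni x}\sum_z w_{z,A}=1$ for all $x$; $w_{z,A}\ge0$. Logarithms base 2. *)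

theory Defs
  imports Complex_Main
begin

text \<open>Points of the cube {0,1}^n: functions nat => bool vanishing (False) outside {0..<n}.
  True encodes bit 1, False encodes bit 0.\<close>
definition cube :: "nat \<Rightarrow> (nat \<Rightarrow> bool) set" where
  "cube n = {x. \<forall>i. n \<le> i \<longrightarrow> x i = False}"

definition prod_dist :: "nat \<Rightarrow> (nat \<Rightarrow> real) \<Rightarrow> (nat \<Rightarrow> bool) \<Rightarrow> real" where
  "prod_dist n q x = (\<Prod>i<n. if x i then q i else 1 - q i)"

datatype dtree = Leaf bool | Node nat dtree dtree

fun dt_eval :: "dtree \<Rightarrow> (nat \<Rightarrow> bool) \<Rightarrow> bool" where
  "dt_eval (Leaf b) x = b"
| "dt_eval (Node i t0 t1) x = (if x i then dt_eval t1 x else dt_eval t0 x)"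

fun dt_depth :: "dtree \<Rightarrow> nat" where
  "dt_depth (Leaf b) = 0"
| "dt_depth (Node i t0 t1) = Suc (max (dt_depth t0) (dt_depth t1))"

fun dt_vars :: "dtree \<Rightarrow> nat set" where
  "dt_vars (Leaf b) = {}"
| "dt_vars (Node i t0 t1) = insert i (dt_vars t0 \<union> dt_vars t1)"

definition dt_err :: "nat \<Rightarrow> (nat \<Rightarrow> real) \<Rightarrow> ((nat \<Rightarrow> bool) \<Rightarrow> bool) \<Rightarrow> dtree \<Rightarrow> real" where
  "dt_err n q g T = (\<Sum>x\<in>{x\<in>cube n. dt_eval T x \<noteq> g x}. prod_dist n q x)"

definition QC :: "nat \<Rightarrow> (nat \<Rightarrow> real) \<Rightarrow> real \<Rightarrow> ((nat \<Rightarrow> bool) \<Rightarrow> bool) \<Rightarrow> nat" where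
  "QC n q eps g = (LEAST d. \<exists>T. dt_vars T \<subseteq> {..<n} \<and> dt_depth T = d \<and> dt_err n q g T \<le> eps)"

text \<open>Subcube supports s \<in> {0,1,*}^n: Some b fixes a coordinate, None is a star.\<close>
definition supports :: "nat \<Rightarrow> (nat \<Rightarrow> bool option) set" where
  "supports n = {s. \<forall>i. n \<le> i \<longrightarrow> s i = None}"

definition in_subcube :: "(nat \<Rightarrow> bool) \<Rightarrow> (nat \<Rightarrow> bool option) \<Rightarrow> bool" where
  "in_subcube x s \<longleftrightarrow> (\<forall>i b. s i = Some b \<longrightarrow> x i = b)"

definition codim :: "nat \<Rightarrow> (nat \<Rightarrow> bool option) \<Rightarrow> nat" where
  "codim n s = card {i\<in>{..<n}. s i \<noteq> None}"

definition qprt_feasible :: "nat \<Rightarrow> real \<Rightarrow> ((nat \<Rightarrow> bool) \<Rightarrow> bool)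
    \<Rightarrow> (bool \<Rightarrow> (nat \<Rightarrow> bool option) \<Rightarrow> real) \<Rightarrow> bool" where
  "qprt_feasible n eps g w \<longleftrightarrow>
     (\<forall>z. \<forall>s\<in>supports n. w z s \<ge> 0)
   \<and> (\<forall>x\<in>cube n. (\<Sum>s\<in>{s\<in>supports n. in_subcube x s}. w (g x) s) \<ge> 1 - eps)
   \<and> (\<forall>x\<in>cube n. (\<Sum>s\<in>{s\<in>supports n. in_subcube x s}. \<Sum>z\<in>UNIV. w z s) = 1)"

definition qprt_obj :: "nat \<Rightarrow> (bool \<Rightarrow> (nat \<Rightarrow> bool option) \<Rightarrow> real) \<Rightarrow> real" where
  "qprt_obj n w = (\<Sum>z\<in>UNIV. \<Sum>s\<in>supports n. w z s * 2 ^ codim n s)"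

definition qprt :: "nat \<Rightarrow> real \<Rightarrow> ((nat \<Rightarrow> bool) \<Rightarrow> bool) \<Rightarrow> real" where
  "qprt n eps g = Inf {qprt_obj n w | w. qprt_feasible n eps g w}"

end

theory Submission
  imports Defs
begin

text \<open>
  A feasible solution gives, for every point \<open>x\<close>, a probability distribution on the labelled
  subcubes through \<open>x\<close>; by Jensen their expected codimension is at most the logarithm \<open>K\<close> of
  the objective. Let \<open>W\<^sub>z(x)\<close> be the mass of the subcubes through \<open>x\<close> labelled \<open>z\<close>. Since
  \<open>W\<^sub>1 + W\<^sub>0 = 1\<close> and \<open>W\<^bsub>g(x)\<^esub>(x) \<ge> 7/8\<close>, either \<open>g\<close> is nearly constant or
  \<open>E W\<^sub>1 E W\<^sub>0 - E (W\<^sub>1 W\<^sub>0)\<close> is at least a constant. Under a product measure, subcubes with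
  no common coordinate are independent, so this difference is at most the probability that
  independently drawn 1- and 0-labelled subcubes share a coordinate. Hence some coordinate is
  fixed by a random subcube with probability of order \<open>1/K\<close>. Querying it lowers the expected
  number of unqueried fixed coordinates by that amount, and as this number starts at most at
  \<open>K\<close>, order \<open>K\<^sup>2\<close> queries suffice on average.
\<close>

subsection \<open>Product measures on the cube\<close>

definition expect :: "nat \<Rightarrow> (nat \<Rightarrow> real) \<Rightarrow> ((nat \<Rightarrow> bool) \<Rightarrow> real) \<Rightarrow> real" where
  "expect n q f = (\<Sum>x\<in>cube n. prod_dist n q x * f x)"

lemma cube_Suc: "cube (Suc n) = cube n \<union> (\<lambda>x. x(n := True)) ` cube n"
proof (intro equalityI subsetI)
  fix x assume x: "x \<in> cube (Suc n)"
  show "x \<in> cube n \<union> (\<lambda>x. x(n := True)) ` cube n"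
  proof (cases "x n")
    case True
    then have "x = (x(n := False))(n := True)" by (simp add: fun_upd_idem)
    moreover have "x(n := False) \<in> cube n"
      using x by (auto simp: cube_def)
    ultimately show ?thesis by blast
  next
    case False
    then have "x \<in> cube n"
      using x by (auto simp: cube_def) (metis Suc_leI le_neq_implies_less)
    then show ?thesis by blast
  qed
qed (auto simp: cube_def)

lemma cube_0: "cube 0 = {\<lambda>_. False}"
  by (auto simp: cube_def)

lemma finite_cube [simp]: "finite (cube n)"
  by (induction n) (simp_all add: cube_0 cube_Suc)

lemma sum_cube_Suc:
  fixes f :: "(nat \<Rightarrow> bool) \<Rightarrow> real"
  shows "(\<Sum>x\<in>cube (Suc n). f x) = (\<Sum>x\<in>cube n. f x + f (x(n := True)))"
proof -
  have "inj_on (\<lambda>x. x(n := True)) (cube n)"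
  proof (rule inj_onI)
    fix x y assume xy: "x \<in> cube n" "y \<in> cube n" "x(n := True) = y(n := True)"
    show "x = y"
    proof
      fix i
      show "x i = y i"
        using xy(1,2) fun_cong[OF xy(3), of i] by (cases "i = n") (auto simp: cube_def)
    qed
  qed
  moreover have "cube n \<inter> (\<lambda>x. x(n := True)) ` cube n = {}"
    by (auto simp: cube_def)
  ultimately show ?thesis
    by (simp add: cube_Suc sum.union_disjoint sum.reindex sum.distrib)
qed

text \<open>Splitting off the last coordinate at each step expands the product. Both the total mass
  1 and the product rule for expectations come from this identity.\<close>

lemma sum_cube_prod:
  fixes f :: "nat \<Rightarrow> bool \<Rightarrow> real"
  shows "(\<Sum>x\<in>cube n. \<Prod>i<n. f i (x i)) = (\<Prod>i<n. f i True + f i False)"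
proof (induction n)
  case (Suc n)
  have "(\<Sum>x\<in>cube (Suc n). \<Prod>i<Suc n. f i (x i))
      = (\<Sum>x\<in>cube n. (\<Prod>i<n. f i (x i)) * (f n True + f n False))"
    unfolding sum_cube_Suc
    by (intro sum.cong) (auto simp: cube_def algebra_simps)
  then show ?case
    by (simp add: Suc.IH flip: sum_distrib_right)
qed (simp add: cube_0)

lemma prod_dist_nonneg:
  assumes "\<forall>i<n. 0 \<le> q i \<and> q i \<le> 1"
  shows "0 \<le> prod_dist n q x"
  unfolding prod_dist_def using assms by (intro prod_nonneg) auto

lemma expect_const [simp]: "expect n q (\<lambda>_. c) = c"
  using sum_cube_prod[of "\<lambda>i b. if b then q i else 1 - q i" n]
  by (simp add: expect_def prod_dist_def flip: sum_distrib_right)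

lemma expect_mono:
  assumes "\<forall>i<n. 0 \<le> q i \<and> q i \<le> 1" "\<And>x. x \<in> cube n \<Longrightarrow> f x \<le> f' x"
  shows "expect n q f \<le> expect n q f'"
  unfolding expect_def by (intro sum_mono mult_left_mono assms prod_dist_nonneg)

lemma expect_sum: "expect n q (\<lambda>x. \<Sum>s\<in>S. f s x) = (\<Sum>s\<in>S. expect n q (f s))"
  unfolding expect_def sum_distrib_left by (rule sum.swap)

lemma expect_cmult: "expect n q (\<lambda>x. c * f x) = c * expect n q f"
  by (simp add: expect_def sum_distrib_left mult_ac)

lemma prod_dist_remove:
  assumes "i < n"
  shows "prod_dist n q x = (if x i then q i else 1 - q i)
           * (\<Prod>j\<in>{..<n} - {i}. if x j then q j else 1 - q j)"
  using assms by (simp add: prod_dist_def prod.remove)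

text \<open>Replacing \<open>q i\<close> by 0 or 1 is conditioning on the bit \<open>x i\<close>; unlike
  a conditional distribution it is also defined when the bit value has probability 0.\<close>

lemma prod_dist_condition:
  assumes "i < n"
  shows "prod_dist n q x
    = q i * prod_dist n (q(i := 1)) x + (1 - q i) * prod_dist n (q(i := 0)) x"
proof -
  have "(\<Prod>j\<in>{..<n} - {i}. if x j then (q(i := b)) j else 1 - (q(i := b)) j)
      = (\<Prod>j\<in>{..<n} - {i}. if x j then q j else 1 - q j)" for b
    by (intro prod.cong) auto
  then show ?thesis
    by (simp add: prod_dist_remove[OF assms])
qed

lemma expect_condition:
  assumes "i < n"
  shows "expect n q f = q i * expect n (q(i := 1)) f + (1 - q i) * expect n (q(i := 0)) f"
  unfolding expect_def prod_dist_condition[OF assms, of q]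
  by (simp add: sum_distrib_left distrib_right mult.assoc flip: sum.distrib)

text \<open>Once \<open>q i\<close> is set to \<open>of_bool b\<close>, every point whose bit
  \<open>i\<close> differs from \<open>b\<close> has mass 0.\<close>

lemma expect_fixed_bit_cong:
  assumes "i < n" "\<And>x. x i = b \<Longrightarrow> f x = f' x"
  shows "expect n (q(i := of_bool b)) f = expect n (q(i := of_bool b)) f'"
  unfolding expect_def
proof (intro sum.cong refl)
  fix x
  have "prod_dist n (q(i := of_bool b)) x = 0" if "x i \<noteq> b"
    using that by (cases b) (auto simp: prod_dist_remove[OF assms(1)])
  then show "prod_dist n (q(i := of_bool b)) x * f x = prod_dist n (q(i := of_bool b)) x * f' x"
    using assms(2) by (cases "x i = b") auto
qed

section \<open>Error of a decision tree under conditioning\<close>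

lemma dt_err_eq_expect: "dt_err n q g T = expect n q (\<lambda>x. of_bool (dt_eval T x \<noteq> g x))"
  unfolding dt_err_def expect_def
  by (subst sum.inter_filter, simp) (intro sum.cong refl, simp)

text \<open>After conditioning on bit \<open>i\<close>, the root's answer is almost surely known, so
  the tree errs exactly as often as the subtree selected.\<close>

lemma dt_err_Node:
  assumes "i < n"
  shows "dt_err n q g (Node i t0 t1)
    = q i * dt_err n (q(i := 1)) g t1 + (1 - q i) * dt_err n (q(i := 0)) g t0"
  unfolding dt_err_eq_expect expect_condition[OF assms, of q]
  using expect_fixed_bit_cong[OF assms, of True "\<lambda>x. of_bool (dt_eval (Node i t0 t1) x \<noteq> g x)"
      "\<lambda>x. of_bool (dt_eval t1 x \<noteq> g x)" q]
    expect_fixed_bit_cong[OF assms, of False "\<lambda>x. of_bool (dt_eval (Node i t0 t1) x \<noteq> g x)"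
      "\<lambda>x. of_bool (dt_eval t0 x \<noteq> g x)" q]
  by simp

lemma dt_err_le_1:
  assumes "\<forall>i<n. 0 \<le> q i \<and> q i \<le> 1"
  shows "dt_err n q g T \<le> 1"
  using expect_mono[OF assms, of "\<lambda>x. of_bool (dt_eval T x \<noteq> g x)" "\<lambda>_. 1"]
  by (simp add: dt_err_eq_expect)


subsection \<open>Weighted families of subcubes\<close>

lemma finite_supports [simp]: "finite (supports n)"
proof -
  have "supports n \<subseteq> {s. \<forall>i. (i \<in> {..<n} \<longrightarrow> s i \<in> UNIV) \<and> (i \<notin> {..<n} \<longrightarrow> s i = None)}"
    by (auto simp: supports_def)
  moreover have "finite \<dots>"
    by (rule finite_set_of_finite_funs) simp_all
  ultimately show ?thesis by (rule finite_subset)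
qed

definition cover :: "nat \<Rightarrow> ((nat \<Rightarrow> bool option) \<Rightarrow> real) \<Rightarrow> (nat \<Rightarrow> bool) \<Rightarrow> real" where
  "cover n v x = (\<Sum>s\<in>supports n. v s * of_bool (in_subcube x s))"

text \<open>If the weights of the subcubes through \<open>x\<close> sum to 1, this is the
  probability that a random one of them fixes \<open>i\<close>.\<close>

definition touch :: "nat \<Rightarrow> ((nat \<Rightarrow> bool option) \<Rightarrow> real) \<Rightarrow> nat \<Rightarrow> (nat \<Rightarrow> bool) \<Rightarrow> real" where
  "touch n v i x = (\<Sum>s\<in>supports n. v s * of_bool (s i \<noteq> None) * of_bool (in_subcube x s))"

text \<open>A query is modelled by setting \<open>q i\<close> to 0 or 1, so these are the
  coordinates whose value is still random.\<close>

definition undetermined :: "nat \<Rightarrow> (nat \<Rightarrow> real) \<Rightarrow> nat set" where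
  "undetermined n q = {i. i < n \<and> 0 < q i \<and> q i < 1}"

lemma finite_undetermined [simp]: "finite (undetermined n q)"
  by (simp add: undetermined_def)

lemma touch_nonneg:
  assumes "\<And>s. s \<in> supports n \<Longrightarrow> 0 \<le> v s"
  shows "0 \<le> touch n v i x"
  unfolding touch_def using assms by (intro sum_nonneg) auto

text \<open>Double counting of pairs of a subcube through \<open>x\<close> and a coordinate that it
  fixes.\<close>

lemma sum_touch: "(\<Sum>i<n. touch n v i x) = cover n (\<lambda>s. v s * real (codim n s)) x"
proof -
  have codim: "real (codim n s) = (\<Sum>i<n. of_bool (s i \<noteq> None))" for s
  proof -
    have "{i \<in> {..<n}. s i \<noteq> None} = {..<n} \<inter> {i. s i \<noteq> None}" by blast
    then show ?thesis unfolding codim_def by (subst sum_of_bool_eq) auto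
  qed
  show ?thesis
    unfolding touch_def cover_def codim sum_distrib_left sum_distrib_right
    by (rule sum.swap)
qed

text \<open>The coordinatewise product form is what allows expectations under a product measure to
  factor.\<close>

lemma in_subcube_supports:
  assumes "s \<in> supports n"
  shows "of_bool (in_subcube x s)
    = (\<Prod>i<n. of_bool (s i = None \<or> s i = Some (x i)) :: real)"
proof -
  have "(\<forall>b. s i = Some b \<longrightarrow> x i = b) \<longleftrightarrow> (i < n \<longrightarrow> s i = None \<or> s i = Some (x i))" for i
    using assms by (cases "s i"; cases "i < n") (auto simp: supports_def)
  then have *: "in_subcube x s \<longleftrightarrow> (\<forall>i<n. s i = None \<or> s i = Some (x i))"
    by (simp only: in_subcube_def)
  show ?thesis
  proof (cases "in_subcube x s")
    case True
    then have "\<forall>i<n. s i = None \<or> s i = Some (x i)" by (simp only: *)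
    then have "(\<Prod>i<n. of_bool (s i = None \<or> s i = Some (x i)) :: real) = 1"
      by (intro prod.neutral) auto
    then show ?thesis using True by simp
  next
    case False
    then have "\<exists>i\<in>{..<n}. of_bool (s i = None \<or> s i = Some (x i)) = (0 :: real)"
      using * by auto
    then have "(\<Prod>i<n. of_bool (s i = None \<or> s i = Some (x i)) :: real) = 0"
      by (intro prod_zero) auto
    then show ?thesis using False by simp
  qed
qed

section \<open>Correlation of subcubes under a product measure\<close>

lemma expect_prod:
  "expect n q (\<lambda>x. \<Prod>i<n. f i (x i)) = (\<Prod>i<n. q i * f i True + (1 - q i) * f i False)"
  using sum_cube_prod[of "\<lambda>i b. (if b then q i else 1 - q i) * f i b" n]
  by (simp only: expect_def prod_dist_def prod.distrib if_True if_False)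

text \<open>Two subcubes without a common undetermined coordinate are independent events, up to
  an inequality at the coordinates where \<open>q\<close> is 0 or 1.\<close>

lemma subcube_positive_correlation:
  assumes q: "\<forall>i<n. 0 \<le> q i \<and> q i \<le> 1"
    and s: "s \<in> supports n" and t: "t \<in> supports n"
    and disj: "\<And>i. i \<in> undetermined n q \<Longrightarrow> s i = None \<or> t i = None"
  shows "expect n q (\<lambda>x. of_bool (in_subcube x s)) * expect n q (\<lambda>x. of_bool (in_subcube x t))
    \<le> expect n q (\<lambda>x. of_bool (in_subcube x s) * of_bool (in_subcube x t))"
  unfolding in_subcube_supports[OF s] in_subcube_supports[OF t] prod.distrib[symmetric]
  unfolding expect_prod[where f = "\<lambda>i b. of_bool (s i = None \<or> s i = Some b)"]
    expect_prod[where f = "\<lambda>i b. of_bool (t i = None \<or> t i = Some b)"]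
    expect_prod[where f = "\<lambda>i b. of_bool (s i = None \<or> s i = Some b) * of_bool (t i = None \<or> t i = Some b)"]
    prod.distrib[symmetric]
proof (rule prod_mono, intro conjI)
  fix i assume "i \<in> {..<n}"
  then have qi: "0 \<le> q i" "q i \<le> 1" and d: "q i = 0 \<or> q i = 1 \<or> s i = None \<or> t i = None"
    using q disj[of i] by (auto simp: undetermined_def)
  show "0 \<le> (q i * of_bool (s i = None \<or> s i = Some True)
            + (1 - q i) * of_bool (s i = None \<or> s i = Some False))
          * (q i * of_bool (t i = None \<or> t i = Some True)
            + (1 - q i) * of_bool (t i = None \<or> t i = Some False))"
    using qi by (intro mult_nonneg_nonneg add_nonneg_nonneg) auto
  \<comment> \<open>The two sides agree in every case of \<open>d\<close>: for \<open>q i\<close>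
    equal to 0 or 1 only one bit value counts, and a star makes one of the two factors 1.\<close>
  show "(q i * of_bool (s i = None \<or> s i = Some True)
            + (1 - q i) * of_bool (s i = None \<or> s i = Some False))
          * (q i * of_bool (t i = None \<or> t i = Some True)
            + (1 - q i) * of_bool (t i = None \<or> t i = Some False))
      \<le> q i * (of_bool (s i = None \<or> s i = Some True) * of_bool (t i = None \<or> t i = Some True))
        + (1 - q i) * (of_bool (s i = None \<or> s i = Some False) * of_bool (t i = None \<or> t i = Some False))"
    using qi d by (auto simp: of_bool_def)
qed

lemma expect_cover:
  "expect n q (cover n v) = (\<Sum>s\<in>supports n. v s * expect n q (\<lambda>x. of_bool (in_subcube x s)))"
  unfolding cover_def by (simp only: expect_sum expect_cmult)

lemma expect_touch:
  "expect n q (touch n v i)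
    = (\<Sum>s\<in>supports n. v s * of_bool (s i \<noteq> None) * expect n q (\<lambda>x. of_bool (in_subcube x s)))"
  unfolding touch_def by (simp only: expect_sum expect_cmult)

lemma expect_cover_mult:
  "expect n q (\<lambda>x. cover n v x * cover n u x)
    = (\<Sum>s\<in>supports n. \<Sum>t\<in>supports n.
        v s * u t * expect n q (\<lambda>x. of_bool (in_subcube x s) * of_bool (in_subcube x t)))"
proof -
  have "cover n v x * cover n u x = (\<Sum>s\<in>supports n. \<Sum>t\<in>supports n.
      v s * u t * (of_bool (in_subcube x s) * of_bool (in_subcube x t)))" for x
    unfolding cover_def sum_product by (intro sum.cong refl) (simp add: mult_ac)
  then show ?thesis
    by (simp only: expect_sum expect_cmult)
qed

text \<open>Both sides are expanded over pairs of subcubes. Pairs with no common undetermined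
  coordinate are handled by \<open>subcube_positive_correlation\<close>; the others are charged to
  the coordinates they share, as in a union bound.\<close>

lemma expect_cover_covariance:
  assumes q: "\<forall>i<n. 0 \<le> q i \<and> q i \<le> 1"
    and v: "\<And>s. s \<in> supports n \<Longrightarrow> 0 \<le> v s"
    and u: "\<And>s. s \<in> supports n \<Longrightarrow> 0 \<le> u s"
  shows "expect n q (cover n v) * expect n q (cover n u)
    \<le> expect n q (\<lambda>x. cover n v x * cover n u x)
      + (\<Sum>i\<in>undetermined n q. expect n q (touch n v i) * expect n q (touch n u i))"
proof -
  define m where "m s = expect n q (\<lambda>x. of_bool (in_subcube x s))" for s
  define mm where "mm s t = expect n q (\<lambda>x. of_bool (in_subcube x s) * of_bool (in_subcube x t))"
    for s t
  \<comment> \<open>The number of undetermined coordinates fixed by both subcubes; it is at least 1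
    for the pairs that are charged.\<close>
  define c where "c s t = (\<Sum>i\<in>undetermined n q. of_bool (s i \<noteq> None) * of_bool (t i \<noteq> None) :: real)"
    for s t :: "nat \<Rightarrow> bool option"
  have m0: "0 \<le> m s" and mm0: "0 \<le> mm s t" for s t
    unfolding m_def mm_def using expect_mono[OF q, of "\<lambda>_. 0"] by simp_all
  have pair: "m s * m t \<le> mm s t + c s t * (m s * m t)"
    if "s \<in> supports n" "t \<in> supports n" for s t
  proof (cases "\<exists>i\<in>undetermined n q. s i \<noteq> None \<and> t i \<noteq> None")
    case True
    then obtain i where i: "i \<in> undetermined n q" "s i \<noteq> None" "t i \<noteq> None" by blast
    have "of_bool (s i \<noteq> None) * of_bool (t i \<noteq> None) \<le> c s t"
      unfolding c_def by (rule member_le_sum) (use i in auto)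
    then have "1 \<le> c s t" using i by simp
    then have "1 * (m s * m t) \<le> c s t * (m s * m t)"
      using m0 by (intro mult_right_mono) auto
    then show ?thesis using mm0[of s t] by simp
  next
    case False
    then have "m s * m t \<le> mm s t"
      unfolding m_def mm_def using that q by (intro subcube_positive_correlation) auto
    moreover have "0 \<le> c s t" by (simp add: c_def sum_nonneg)
    ultimately show ?thesis using m0 by (smt (verit) mult_nonneg_nonneg)
  qed
  have touches: "(\<Sum>i\<in>undetermined n q. expect n q (touch n v i) * expect n q (touch n u i))
      = (\<Sum>s\<in>supports n. \<Sum>t\<in>supports n. v s * u t * (c s t * (m s * m t)))"
    (is "?l = ?r")
  proof -
    have "?l = (\<Sum>i\<in>undetermined n q. \<Sum>s\<in>supports n. \<Sum>t\<in>supports n.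
        v s * u t * ((of_bool (s i \<noteq> None) * of_bool (t i \<noteq> None)) * (m s * m t)))"
      unfolding expect_touch sum_product m_def by (intro sum.cong refl) (simp add: mult_ac)
    also have "\<dots> = (\<Sum>s\<in>supports n. \<Sum>i\<in>undetermined n q. \<Sum>t\<in>supports n.
        v s * u t * ((of_bool (s i \<noteq> None) * of_bool (t i \<noteq> None)) * (m s * m t)))"
      by (rule sum.swap)
    also have "\<dots> = (\<Sum>s\<in>supports n. \<Sum>t\<in>supports n. \<Sum>i\<in>undetermined n q.
        v s * u t * ((of_bool (s i \<noteq> None) * of_bool (t i \<noteq> None)) * (m s * m t)))"
      by (intro sum.cong refl sum.swap)
    also have "\<dots> = ?r"
      by (simp only: c_def sum_distrib_left[symmetric] sum_distrib_right[symmetric])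
    finally show ?thesis .
  qed
  have "expect n q (cover n v) * expect n q (cover n u)
      = (\<Sum>s\<in>supports n. \<Sum>t\<in>supports n. v s * u t * (m s * m t))"
    unfolding expect_cover sum_product m_def by (intro sum.cong refl) (simp add: mult_ac)
  also have "\<dots> \<le> (\<Sum>s\<in>supports n. \<Sum>t\<in>supports n. v s * u t * (mm s t + c s t * (m s * m t)))"
    using pair v u by (intro sum_mono mult_left_mono) auto
  also have "\<dots> = expect n q (\<lambda>x. cover n v x * cover n u x)
      + (\<Sum>i\<in>undetermined n q. expect n q (touch n v i) * expect n q (touch n u i))"
    unfolding touches expect_cover_mult mm_def[symmetric]
    by (simp add: distrib_left sum.distrib)
  finally show ?thesis .
qed


subsection \<open>The potential\<close>

text \<open>For \<open>v = total_weight w\<close> with \<open>w\<close> feasible, this is the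
  expected number of still random coordinates fixed by a random subcube through a random
  point.\<close>

definition potential :: "nat \<Rightarrow> ((nat \<Rightarrow> bool option) \<Rightarrow> real) \<Rightarrow> (nat \<Rightarrow> real) \<Rightarrow> real" where
  "potential n v q = (\<Sum>i\<in>undetermined n q. expect n q (touch n v i))"

text \<open>Either answer removes exactly \<open>i\<close> from the undetermined set, and the terms
  of the other coordinates average back to their values under \<open>q\<close>.\<close>

lemma potential_condition:
  assumes "i \<in> undetermined n q"
  shows "q i * potential n v (q(i := 1)) + (1 - q i) * potential n v (q(i := 0))
    = potential n v q - expect n q (touch n v i)"
proof -
  have i: "i < n" using assms by (simp add: undetermined_def)
  have "undetermined n (q(i := 1)) = undetermined n q - {i}"
    "undetermined n (q(i := 0)) = undetermined n q - {i}"
    by (auto simp: undetermined_def)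
  then have "q i * potential n v (q(i := 1)) + (1 - q i) * potential n v (q(i := 0))
      = (\<Sum>j\<in>undetermined n q - {i}. expect n q (touch n v j))"
    by (simp add: potential_def expect_condition[OF i, of q] sum_distrib_left sum.distrib)
  then show ?thesis
    using assms by (simp add: potential_def sum_diff1)
qed

lemma potential_nonneg:
  assumes "\<forall>i<n. 0 \<le> q i \<and> q i \<le> 1" "\<And>s. s \<in> supports n \<Longrightarrow> 0 \<le> v s"
  shows "0 \<le> potential n v q"
  unfolding potential_def
  using expect_mono[OF assms(1), of "\<lambda>_. 0" "touch n v _"] touch_nonneg[of n v] assms(2)
  by (intro sum_nonneg) simp

text \<open>The potential counts only some of the fixed coordinates, so it is at most an average
  codimension. The bound is uniform in \<open>q\<close> and hence available at every node of the
  tree.\<close>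

lemma potential_le:
  assumes q: "\<forall>i<n. 0 \<le> q i \<and> q i \<le> 1"
    and v: "\<And>s. s \<in> supports n \<Longrightarrow> 0 \<le> v s"
    and K: "\<And>x. x \<in> cube n \<Longrightarrow> cover n (\<lambda>s. v s * real (codim n s)) x \<le> K"
  shows "potential n v q \<le> K"
proof -
  have "potential n v q = expect n q (\<lambda>x. \<Sum>i\<in>undetermined n q. touch n v i x)"
    by (simp add: potential_def expect_sum)
  also have "\<dots> \<le> expect n q (\<lambda>_. K)"
  proof (rule expect_mono[OF q])
    fix x assume "x \<in> cube n"
    have "(\<Sum>i\<in>undetermined n q. touch n v i x) \<le> (\<Sum>i<n. touch n v i x)"
      using touch_nonneg[of n v] v by (intro sum_mono2) (auto simp: undetermined_def)
    also have "\<dots> \<le> K" using K[OF \<open>x \<in> cube n\<close>] by (simp add: sum_touch)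
    finally show "(\<Sum>i\<in>undetermined n q. touch n v i x) \<le> K" .
  qed
  finally show ?thesis by simp
qed


subsection \<open>Solutions of the partition linear program\<close>

definition total_weight :: "(bool \<Rightarrow> (nat \<Rightarrow> bool option) \<Rightarrow> real) \<Rightarrow> (nat \<Rightarrow> bool option) \<Rightarrow> real" where
  "total_weight w s = w True s + w False s"

lemma cover_eq_sum: "cover n v x = (\<Sum>s\<in>{s\<in>supports n. in_subcube x s}. v s)"
  unfolding cover_def by (subst sum.inter_filter, simp) (intro sum.cong refl, simp)

lemma qprt_feasible_cover:
  "qprt_feasible n eps g w \<longleftrightarrow>
     (\<forall>z. \<forall>s\<in>supports n. 0 \<le> w z s)
   \<and> (\<forall>x\<in>cube n. 1 - eps \<le> cover n (w (g x)) x)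
   \<and> (\<forall>x\<in>cube n. cover n (total_weight w) x = 1)"
  by (simp add: qprt_feasible_def cover_eq_sum total_weight_def UNIV_bool add.commute)

lemma cover_total_weight: "cover n (total_weight w) x = cover n (w True) x + cover n (w False) x"
  by (simp add: cover_eq_sum total_weight_def sum.distrib)

lemma expect_touch_total_weight:
  "expect n q (touch n (total_weight w) i)
    = expect n q (touch n (w True) i) + expect n q (touch n (w False) i)"
  by (simp only: expect_touch total_weight_def distrib_right sum.distrib)

lemma total_weight_nonneg:
  assumes "qprt_feasible n eps g w" "s \<in> supports n"
  shows "0 \<le> total_weight w s"
  using assms by (simp add: qprt_feasible_def total_weight_def)

lemma cover_pow_codim_le_qprt_obj:
  assumes "qprt_feasible n eps g w"
  shows "cover n (\<lambda>s. total_weight w s * 2 ^ codim n s) x \<le> qprt_obj n w"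
proof -
  have "qprt_obj n w = (\<Sum>s\<in>supports n. total_weight w s * 2 ^ codim n s)"
    by (simp add: qprt_obj_def total_weight_def UNIV_bool distrib_right sum.distrib)
  then show ?thesis
    unfolding cover_eq_sum using total_weight_nonneg[OF assms]
    by (auto intro!: sum_mono2)
qed

text \<open>Subcubes through a single point already have total weight 1, and each factor
  \<open>2 ^ codim n s\<close> is at least 1.\<close>

lemma qprt_obj_ge_1:
  assumes "qprt_feasible n eps g w"
  shows "1 \<le> qprt_obj n w"
proof -
  define x :: "nat \<Rightarrow> bool" where "x = (\<lambda>_. False)"
  have "1 = cover n (total_weight w) x"
    using assms by (simp add: qprt_feasible_cover x_def cube_def)
  also have "\<dots> \<le> cover n (\<lambda>s. total_weight w s * 2 ^ codim n s) x"
    unfolding cover_eq_sum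
  proof (rule sum_mono)
    fix s assume "s \<in> {s \<in> supports n. in_subcube x s}"
    then show "total_weight w s \<le> total_weight w s * 2 ^ codim n s"
      using mult_left_mono[of 1 "2 ^ codim n s" "total_weight w s"] total_weight_nonneg[OF assms, of s]
      by simp
  qed
  also have "\<dots> \<le> qprt_obj n w"
    by (rule cover_pow_codim_le_qprt_obj[OF assms])
  finally show ?thesis .
qed

text \<open>Jensen's inequality for the weights of the subcubes through \<open>x\<close>, which sum to 1.\<close>

lemma cover_codim_le_log_qprt_obj:
  assumes w: "qprt_feasible n eps g w" and x: "x \<in> cube n"
  shows "cover n (\<lambda>s. total_weight w s * real (codim n s)) x \<le> log 2 (qprt_obj n w)"
proof -
  define S where "S = {s\<in>supports n. in_subcube x s}"
  define p where "p = qprt_obj n w"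
  have p: "0 < p" using qprt_obj_ge_1[OF w] by (simp add: p_def)
  \<comment> \<open>The inequality \<open>1 + y <= exp y\<close> at
    \<open>y = k * ln 2 - ln p\<close>; averaging it over the subcubes through \<open>x\<close>
    replaces an appeal to concavity of the logarithm.\<close>
  have tangent: "1 - ln p + ln 2 * real k \<le> 2 ^ k / p" for k
  proof -
    have "exp (real k * ln 2 - ln p) = 2 ^ k / p"
      using p by (simp add: exp_diff exp_of_nat_mult)
    then show ?thesis
      using exp_ge_add_one_self[of "real k * ln 2 - ln p"] by (simp add: mult.commute)
  qed
  have one: "(\<Sum>s\<in>S. total_weight w s) = 1"
    using w x by (simp add: qprt_feasible_cover cover_eq_sum S_def)
  have "1 - ln p + ln 2 * (\<Sum>s\<in>S. total_weight w s * real (codim n s))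
      = (1 - ln p) * (\<Sum>s\<in>S. total_weight w s) + ln 2 * (\<Sum>s\<in>S. total_weight w s * real (codim n s))"
    by (simp add: one)
  also have "\<dots> = (\<Sum>s\<in>S. total_weight w s * (1 - ln p + ln 2 * real (codim n s)))"
    unfolding sum_distrib_left sum.distrib[symmetric]
    by (intro sum.cong refl) (simp add: algebra_simps)
  also have "\<dots> \<le> (\<Sum>s\<in>S. total_weight w s * (2 ^ codim n s / p))"
    by (intro sum_mono mult_left_mono tangent total_weight_nonneg[OF w]) (simp add: S_def)
  also have "\<dots> = (\<Sum>s\<in>S. total_weight w s * 2 ^ codim n s) / p"
    by (simp add: sum_divide_distrib)
  also have "\<dots> \<le> 1"
    using cover_pow_codim_le_qprt_obj[OF w, of x] p by (simp add: cover_eq_sum S_def p_def)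
  finally show ?thesis
    by (simp add: cover_eq_sum S_def p_def log_def field_simps)
qed

text \<open>Each point, taken as a subcube of codimension \<open>n\<close>, gets weight 1 on its
  correct label. This makes the set under \<open>Inf\<close> in \<open>qprt\<close>
  nonempty.\<close>

lemma ex_qprt_feasible:
  assumes "0 \<le> eps"
  shows "\<exists>w. qprt_feasible n eps g w"
proof -
  define pt :: "(nat \<Rightarrow> bool) \<Rightarrow> nat \<Rightarrow> bool option"
    where "pt y = (\<lambda>i. if i < n then Some (y i) else None)" for y
  define w :: "bool \<Rightarrow> (nat \<Rightarrow> bool option) \<Rightarrow> real"
    where "w z s = of_bool (\<exists>y\<in>cube n. s = pt y \<and> z = g y)" for z s
  have pt_eq: "y = x" if "x \<in> cube n" "y \<in> cube n" "in_subcube x (pt y)" for x y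
  proof
    fix i show "y i = x i"
      using that by (cases "i < n") (auto simp: in_subcube_def pt_def cube_def)
  qed
  have cover: "cover n (w z) x = of_bool (z = g x)" if x: "x \<in> cube n" for x z
  proof -
    let ?S = "{s \<in> supports n. in_subcube x s}"
    have "pt x \<in> ?S"
      by (auto simp: in_subcube_def supports_def pt_def split: if_splits)
    moreover have "w z s = (if s = pt x then of_bool (z = g x) else 0)" if "s \<in> ?S" for s
    proof -
      have "(\<exists>y\<in>cube n. s = pt y \<and> z = g y) \<longleftrightarrow> s = pt x \<and> z = g x"
        using that x pt_eq[OF x] by blast
      then show ?thesis by (simp only: w_def) simp
    qed
    then have "(\<Sum>s\<in>?S. w z s) = (\<Sum>s\<in>?S. if s = pt x then of_bool (z = g x) else 0)"
      by (intro sum.cong refl)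
    moreover have "finite ?S" by simp
    ultimately show ?thesis
      unfolding cover_eq_sum by (simp only: sum.delta) simp
  qed
  have "qprt_feasible n eps g w"
    unfolding qprt_feasible_cover cover_total_weight
    using assms by (auto simp: cover w_def)
  then show ?thesis by blast
qed

lemma qprt_ge_1:
  assumes "0 \<le> eps"
  shows "1 \<le> qprt n eps g"
  unfolding qprt_def
  by (rule cInf_greatest) (use ex_qprt_feasible[OF assms] qprt_obj_ge_1 in auto)

text \<open>A solution within 1 of the infimum is taken instead of a minimizer. Since
  \<open>qprt\<close> is at least 1, this at most doubles the objective and adds at most 1 to its
  logarithm.\<close>

lemma near_optimal_solution:
  assumes "0 \<le> eps"
  shows "\<exists>w. qprt_feasible n eps g w \<and> log 2 (qprt_obj n w) \<le> log 2 (qprt n eps g) + 1"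
proof -
  have "\<exists>r\<in>{qprt_obj n w | w. qprt_feasible n eps g w}. r < qprt n eps g + 1"
    unfolding qprt_def by (rule cInf_lessD) (use ex_qprt_feasible[OF assms] in auto)
  then obtain w where w: "qprt_feasible n eps g w" "qprt_obj n w < qprt n eps g + 1"
    by auto
  then have "qprt_obj n w \<le> qprt n eps g * 2"
    using qprt_ge_1[OF assms, of n g] by simp
  then have "log 2 (qprt_obj n w) \<le> log 2 (qprt n eps g * 2)"
    using qprt_obj_ge_1[OF w(1)] by simp
  also have "\<dots> = log 2 (qprt n eps g) + 1"
    using qprt_ge_1[OF assms, of n g] by (simp add: log_mult)
  finally show ?thesis using w(1) by blast
qed


subsection \<open>The decision tree\<close>

text \<open>If all undetermined coordinates were rarely touched, the covers for the two labels would
  be nearly uncorrelated; but both have large mean while their product is small everywhere.\<close>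

lemma influential_coordinate:
  assumes w: "qprt_feasible n (1/8) g w"
    and q: "\<forall>i<n. 0 \<le> q i \<and> q i \<le> 1"
    and K: "0 < K" "potential n (total_weight w) q \<le> K"
    and unbiased: "\<And>b. 48/100 < dt_err n q g (Leaf b)"
  shows "\<exists>i\<in>undetermined n q. 1 / (40 * K) \<le> expect n q (touch n (total_weight w) i)"
proof (rule ccontr)
  assume "\<not> ?thesis"
  then have small: "expect n q (touch n (total_weight w) i) \<le> 1 / (40 * K)"
    if "i \<in> undetermined n q" for i
    using that by force
  have w0: "0 \<le> w z s" if "s \<in> supports n" for z s
    using w that by (simp add: qprt_feasible_def)
  have touch0: "0 \<le> expect n q (touch n (w z) i)" for z i
    using expect_mono[OF q, of "\<lambda>_. 0" "touch n (w z) i"] touch_nonneg[of n "w z"] w0 by simp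
  have sum1: "cover n (w True) x + cover n (w False) x = 1"
    and major: "7/8 \<le> cover n (w (g x)) x" if "x \<in> cube n" for x
    using w that unfolding qprt_feasible_cover cover_total_weight by auto
  have cover0: "0 \<le> cover n (w z) x" for z x
    unfolding cover_eq_sum using w0 by (auto intro: sum_nonneg)
  have big: "42/100 \<le> expect n q (cover n (w z))" for z
  proof -
    \<comment> \<open>The leaf \<open>\<not> z\<close> errs exactly where \<open>g\<close> equals
      \<open>z\<close>, and there the cover by label \<open>z\<close> is at least 7/8;
      \<open>7/8 * 48/100 = 42/100\<close>.\<close>
    have "42/100 \<le> 7/8 * dt_err n q g (Leaf (\<not> z))"
      using unbiased[of "\<not> z"] by simp
    also have "\<dots> = expect n q (\<lambda>x. 7/8 * of_bool (g x = z))"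
    proof -
      have "(\<lambda>x. of_bool (dt_eval (Leaf (\<not> z)) x \<noteq> g x)) = (\<lambda>x. of_bool (g x = z) :: real)"
        by auto
      then show ?thesis by (simp only: dt_err_eq_expect expect_cmult)
    qed
    also have "\<dots> \<le> expect n q (cover n (w z))"
      using major cover0 by (intro expect_mono[OF q]) auto
    finally show ?thesis .
  qed
  have "(42/100) * (42/100) \<le> expect n q (cover n (w True)) * expect n q (cover n (w False))"
    using big[of True] big[of False] by (intro mult_mono) auto
  also have "\<dots> \<le> expect n q (\<lambda>x. cover n (w True) x * cover n (w False) x)
      + (\<Sum>i\<in>undetermined n q. expect n q (touch n (w True) i) * expect n q (touch n (w False) i))"
    using w0 by (intro expect_cover_covariance[OF q])
  also have "expect n q (\<lambda>x. cover n (w True) x * cover n (w False) x) \<le> expect n q (\<lambda>_. 7/64)"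
  proof (rule expect_mono[OF q])
    fix x assume x: "x \<in> cube n"
    define a where "a = cover n (w (g x)) x"
    have "cover n (w True) x * cover n (w False) x = a * (1 - a)"
      using sum1[OF x] by (cases "g x") (simp_all add: a_def eq_diff_eq[symmetric])
    \<comment> \<open>This expands to \<open>a * (1 - a) <= 7/64\<close>; both factors are
      nonnegative because \<open>a\<close> is at least 7/8.\<close>
    moreover have "0 \<le> (a - 7/8) * (a - 1/8)"
      using major[OF x] by (simp add: a_def)
    then have "a * (1 - a) \<le> 7/64" by (simp add: field_simps)
    ultimately show "cover n (w True) x * cover n (w False) x \<le> 7/64"
      by simp
  qed
  also have "(\<Sum>i\<in>undetermined n q. expect n q (touch n (w True) i) * expect n q (touch n (w False) i))
      \<le> (\<Sum>i\<in>undetermined n q. 1 / (40 * K) * expect n q (touch n (total_weight w) i))"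
  proof (intro sum_mono mult_mono)
    fix i assume "i \<in> undetermined n q"
    then show "expect n q (touch n (w True) i) \<le> 1 / (40 * K)"
      using small[of i] touch0[of False i] by (simp add: expect_touch_total_weight)
    show "expect n q (touch n (w False) i) \<le> expect n q (touch n (total_weight w) i)"
      using touch0[of True i] by (simp add: expect_touch_total_weight)
  qed (use touch0 K in auto)
  also have "\<dots> = 1 / (40 * K) * potential n (total_weight w) q"
    by (simp only: potential_def sum_distrib_left)
  also have "\<dots> \<le> 1 / (40 * K) * K"
    using K by (intro mult_left_mono) auto
  \<comment> \<open>The chain would give \<open>0.1764 <= 7/64 + 1/40\<close>, but the right side is
    below 0.135.\<close>
  finally show False
    using K by simp
qed

text \<open>\<open>D\<close> is the whole query budget and \<open>d\<close> what remains of it. The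
  term \<open>1 - d / D\<close> rises by \<open>1 / D\<close> per query, while the potential term
  falls on average by at least as much. For \<open>d = D\<close> the last term vanishes; for
  \<open>d = 0\<close> it is 1, so cutting the tree off there is harmless.\<close>

lemma ex_decision_tree:
  assumes w: "qprt_feasible n (1/8) g w"
    and K: "0 < K" "\<And>x. x \<in> cube n \<Longrightarrow> cover n (\<lambda>s. total_weight w s * real (codim n s)) x \<le> K"
    and D: "0 < D"
  shows "\<lbrakk>d \<le> D; \<forall>i<n. 0 \<le> q i \<and> q i \<le> 1\<rbrakk> \<Longrightarrow>
    \<exists>T. dt_vars T \<subseteq> {..<n} \<and> dt_depth T \<le> d \<and>
      dt_err n q g T \<le> 48/100 + 40 * K * potential n (total_weight w) q / real D + (1 - real d / real D)"
proof (induction d arbitrary: q)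
  case 0
  have "0 \<le> 40 * K * potential n (total_weight w) q / real D"
    using K(1) potential_nonneg[OF 0(2) total_weight_nonneg[OF w]] by simp
  then show ?case
    using dt_err_le_1[OF 0(2), of g "Leaf True"] by (intro exI[of _ "Leaf True"]) auto
next
  case (Suc d)
  note q = Suc.prems(2)
  show ?case
  proof (cases "\<exists>b. dt_err n q g (Leaf b) \<le> 48/100")
    case True
    then obtain b where "dt_err n q g (Leaf b) \<le> 48/100" by blast
    moreover have "0 \<le> 40 * K * potential n (total_weight w) q / real D"
      using K(1) potential_nonneg[OF q total_weight_nonneg[OF w]] by simp
    moreover have "real (Suc d) / real D \<le> 1"
      using Suc.prems(1) D by simp
    ultimately show ?thesis by (intro exI[of _ "Leaf b"]) auto
  next
    case False
    define P where "P = potential n (total_weight w)"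
    have "P q \<le> K"
      unfolding P_def by (rule potential_le[OF q total_weight_nonneg[OF w] K(2)])
    then obtain i where i: "i \<in> undetermined n q"
      and touch: "1 / (40 * K) \<le> expect n q (touch n (total_weight w) i)"
      using influential_coordinate[OF w q K(1)] False by (auto simp: P_def not_le)
    have i_less: "i < n" and qi: "0 \<le> q i" "q i \<le> 1"
      using i by (auto simp: undetermined_def)
    have "\<exists>T. dt_vars T \<subseteq> {..<n} \<and> dt_depth T \<le> d \<and>
        dt_err n (q(i := b)) g T \<le> 48/100 + 40 * K * P (q(i := b)) / real D + (1 - real d / real D)"
      if "b \<in> {0, 1}" for b
      unfolding P_def by (rule Suc.IH) (use Suc.prems that in auto)
    from this[of 0] this[of 1] obtain t0 t1 where
      t0: "dt_vars t0 \<subseteq> {..<n}" "dt_depth t0 \<le> d"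
        "dt_err n (q(i := 0)) g t0 \<le> 48/100 + 40 * K * P (q(i := 0)) / real D + (1 - real d / real D)"
      and t1: "dt_vars t1 \<subseteq> {..<n}" "dt_depth t1 \<le> d"
        "dt_err n (q(i := 1)) g t1 \<le> 48/100 + 40 * K * P (q(i := 1)) / real D + (1 - real d / real D)"
      by auto
    define c where "c = 48/100 + (1 - real d / real D)"
    define a where "a = 40 * K / real D"
    have a: "0 \<le> a" using K(1) by (simp add: a_def)
    have "dt_err n q g (Node i t0 t1)
        = q i * dt_err n (q(i := 1)) g t1 + (1 - q i) * dt_err n (q(i := 0)) g t0"
      by (rule dt_err_Node[OF i_less])
    also have "\<dots> \<le> q i * (c + a * P (q(i := 1))) + (1 - q i) * (c + a * P (q(i := 0)))"
      using t0(3) t1(3) qi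
      by (intro add_mono mult_left_mono) (auto simp: a_def c_def)
    also have "\<dots> = c + a * (q i * P (q(i := 1)) + (1 - q i) * P (q(i := 0)))"
      by (simp add: algebra_simps)
    also have "\<dots> = c + a * (P q - expect n q (touch n (total_weight w) i))"
      unfolding P_def potential_condition[OF i] ..
    also have "\<dots> \<le> c + a * (P q - 1 / (40 * K))"
      using touch a by (intro add_left_mono mult_left_mono) auto
    \<comment> \<open>Since \<open>a / (40 * K) = 1 / D\<close>, the gain in potential turns
      \<open>1 - d / D\<close> into \<open>1 - Suc d / D\<close>.\<close>
    also have "\<dots> = 48/100 + 40 * K * P q / real D + (1 - real (Suc d) / real D)"
      using K(1) D by (simp add: a_def c_def field_simps)
    finally show ?thesis
      using t0(1,2) t1(1,2) i_less
      by (intro exI[of _ "Node i t0 t1"]) (auto simp: P_def)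
  qed
qed

section \<open>Choice of the depth and the final bound\<close>

lemma QC_le:
  assumes "dt_vars T \<subseteq> {..<n}" "dt_err n q g T \<le> eps"
  shows "QC n q eps g \<le> dt_depth T"
  unfolding QC_def by (rule Least_le) (use assms in blast)

lemma QC_le_log_qprt_squared:
  assumes q: "\<forall>i<n. 0 \<le> q i \<and> q i \<le> 1"
  shows "real (QC n q 0.49 g) \<le> 4000 * (log 2 (qprt n (1/8) g) + 1)\<^sup>2 + 4001"
proof -
  define K where "K = max 1 (log 2 (qprt n (1/8) g) + 1)"
  \<comment> \<open>The factor \<open>4000 = 40 * 100\<close> makes the potential term at most
    1/100, the gap between the threshold 48/100 for stopping at a leaf and the allowed error
    0.49.\<close>
  define D where "D = nat \<lceil>4000 * K\<^sup>2\<rceil>"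
  have "0 \<le> log 2 (qprt n (1/8) g)"
    using qprt_ge_1[of "1/8" n g] by simp
  then have K: "K = log 2 (qprt n (1/8) g) + 1" "1 \<le> K"
    by (auto simp: K_def)
  have D: "4000 * K\<^sup>2 \<le> real D" "real D \<le> 4000 * K\<^sup>2 + 1"
    unfolding D_def by (simp_all add: le_of_int_ceiling ceiling_correct)
  have "1 \<le> K\<^sup>2" using K(2) by (simp add: one_le_power)
  then have D0: "0 < real D" using D(1) by linarith
  obtain w where w: "qprt_feasible n (1/8) g w" "log 2 (qprt_obj n w) \<le> K"
    using near_optimal_solution[of "1/8" n g] by (auto simp: K(1))
  have cover: "cover n (\<lambda>s. total_weight w s * real (codim n s)) x \<le> K" if "x \<in> cube n" for x
    using cover_codim_le_log_qprt_obj[OF w(1) that] w(2) by linarith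
  obtain T where T: "dt_vars T \<subseteq> {..<n}" "dt_depth T \<le> D"
    "dt_err n q g T \<le> 48/100 + 40 * K * potential n (total_weight w) q / real D"
    using ex_decision_tree[OF w(1) _ cover, of D D q] K(2) D0 q by auto
  have "40 * K * potential n (total_weight w) q \<le> 40 * K * K"
    using potential_le[OF q total_weight_nonneg[OF w(1)] cover] K(2) by (intro mult_left_mono) auto
  also have "\<dots> \<le> 1/100 * real D"
    using D(1) by (simp add: power2_eq_square)
  finally have "40 * K * potential n (total_weight w) q / real D \<le> 1/100"
    using D0 by (simp add: divide_le_eq)
  then have "dt_err n q g T \<le> 0.49"
    using T(3) by simp
  then have "QC n q 0.49 g \<le> D"
    using QC_le[OF T(1)] T(2) by (meson le_trans)
  then show ?thesis
    using D(2) by (simp add: K(1))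
qed

theorem theorem2:
  "\<exists>C::real. C > 0 \<and>
     (\<forall>n::nat. \<forall>g::(nat \<Rightarrow> bool) \<Rightarrow> bool. \<forall>q::nat \<Rightarrow> real.
        n \<ge> 1 \<longrightarrow> (\<forall>i<n. 0 \<le> q i \<and> q i \<le> 1) \<longrightarrow>
        real (QC n q 0.49 g)
          \<le> C * (log 2 (qprt n (1/8) g) * log 2 (log 2 (qprt n (1/8) g)))\<^sup>2 + C)"
proof (intro exI[of _ 40001] conjI allI impI)
  fix n :: nat and g :: "(nat \<Rightarrow> bool) \<Rightarrow> bool" and q :: "nat \<Rightarrow> real"
  assume q: "\<forall>i<n. 0 \<le> q i \<and> q i \<le> 1"
  define L where "L = log 2 (qprt n (1/8) g)"
  have L0: "0 \<le> L" using qprt_ge_1[of "1/8" n g] by (simp add: L_def)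
  have QC: "real (QC n q 0.49 g) \<le> 4000 * (L + 1)\<^sup>2 + 4001"
    unfolding L_def by (rule QC_le_log_qprt_squared[OF q])
  show "real (QC n q 0.49 g) \<le> 40001 * (L * log 2 L)\<^sup>2 + 40001"
  proof (cases "L \<le> 2")
    case True
    \<comment> \<open>For small \<open>L\<close> the additive constant covers everything:
      \<open>4000 * 9 + 4001 = 40001\<close>. Of the double logarithm, possibly negative or taken at
      0, only the nonnegativity of the square enters.\<close>
    then have "(L + 1)\<^sup>2 \<le> 9" using L0 power_mono[of "L + 1" 3 2] by simp
    moreover have "0 \<le> (L * log 2 L)\<^sup>2" by simp
    ultimately show ?thesis using QC by linarith
  next
    case False
    \<comment> \<open>For \<open>L > 2\<close> the double logarithm can only enlarge the bound, and
      \<open>(L + 1)\<^sup>2\<close> is at most \<open>4 * L\<^sup>2\<close>.\<close>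
    then have "1 \<le> log 2 L" by (simp add: le_log_iff)
    then have "L * 1 \<le> L * log 2 L" using L0 by (intro mult_left_mono) auto
    then have "L\<^sup>2 \<le> (L * log 2 L)\<^sup>2" using L0 by (intro power_mono) auto
    moreover have "(L + 1)\<^sup>2 \<le> (2 * L)\<^sup>2" using False by (intro power_mono) auto
    ultimately show ?thesis using QC by (simp add: power_mult_distrib)
  qed
qed simp

end
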